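(* Let $y_0,\zeta\in\mathbb{R}^n$, $y_\zeta=y_0+\zeta$ and $\lambda>0$. Let $\eta$ be either a dual certificate $\eta_0=K_*p_0$ for the interpolation problem $(P_0)$, with $p_0$ a solution of its dual $(D_0)$, or the dual certificate $\eta_{\lambda,\zeta}=K_*p_{\lambda,\zeta}$ for the training problem $(P_\lambda)$, with $p_{\lambda,\zeta}$ the solution of its dual $(D_\lambda)$. Then the absolute value $|\eta|$ achieves its maximum (over $\mathbb{S}^{d-1}$) in at most $$\max_{0\le k\le n}\binom nk\,\Xi(n-k,d-k)$$ points, where $\Xi(n-k,d-k)$ denotes the number of non-empty regions induced in $\mathbb{R}^{d-k}$ by an arrangement of $n-k$ hyperplanes, with the convention that $\Xi(n-k,d-k)=0$ when $d-k<0$.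
   Context: Setting. $d,n$ are positive integers, $x^1,\dots,x^n\in\mathbb{R}^d\setminus\{0\}$ are given data points, and $\sigma(z)=\max\{0,z\}$ is the ReLU function. $M(\mathbb{S}^{d-1})$ is the space of finite signed Radon measures on the unit sphere $\mathbb{S}^{d-1}\subset\mathbb{R}^d$, with total variation norm $\|\cdot\|_{\mathrm{TV}}$. The operator $K:M(\mathbb{S}^{d-1})\to\mathbb{R}^n$ is $(K\mu)_j=\int_{\mathbb{S}^{d-1}}\sigma(\langle w,x^j\rangle)\,d\mu(w)$, and $K_*:\mathbb{R}^n\to C(\mathbb{S}^{d-1})$ is $K_*p(w)=\sum_{j=1}^np^j\sigma(\langle w,x^j\rangle)$. Interpolation problem $(P_0)$: minimize $\|\mu\|_{\mathrm{TV}}$ over $\mu\in M(\mathbb{S}^{d-1})$ with $K\mu=y_0$. Its dual $(D_0)$: maximize $\langle p,y_0\rangle$ over $p\in\mathbb{R}^n$ with $\|K_*p\|_\infty\le1$. Training problem $(P_\lambda)$: minimize $\frac12\|K\mu-y_\zeta\|^2+\lambda\|\mu\|_{\mathrm{TV}}$ over $\mu\in M(\mathbb{S}^{d-1})$. Its dual $(D_\lambda)$: maximize $\langle y_\zeta,p\rangle-\frac\lambda2\|p\|^2$ over $p\in\mathbb{R}^n$ with $\|K_*p\|_\infty\le1$; it has a unique solution. The arrangements meant in the definition of $\Xi$ consist of hyperplanes through the origin, and $\Xi(m,D)$ is the maximal number of non-empty regions: the maximum, over $a^1,\dots,a^m\in\mathbb{R}^D$, of the number of sign patterns $\pi\in\{0,1\}^m$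 for which the set $\{v\in\mathbb{R}^D:\langle v,a^i\rangle>0\text{ if }\pi_i=1,\ \langle v,a^i\rangle<0\text{ if }\pi_i=0,\ i=1,\dots,m\}$ is non-empty.
   Formalization: The formal statement additionally assumes that d = 1 or that η is not identically zero on the sphere; for d ≥ 2 and η = 0 (e.g. y_0 = 0, p_0 = 0) every point of the infinite sphere is a maximizer and the claim is false. *)

theory Defs
  imports "HOL-Analysis.Analysis"
begin

definition relu :: "real \<Rightarrow> real" where
  "relu z = max 0 z"

(* K_* p. It is a function on all of real^'d here; only its values on sphere 0 1 are ever used. *)
definition K_adj :: "('n::finite \<Rightarrow> real^'d) \<Rightarrow> real^'n \<Rightarrow> real^'d \<Rightarrow> real" where
  "K_adj x p w = (\<Sum>j\<in>UNIV. p $ j * relu (w \<bullet> x j))"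

definition sphere_sup_norm :: "(real^'d \<Rightarrow> real) \<Rightarrow> real" where
  "sphere_sup_norm f = (SUP w\<in>sphere 0 1. \<bar>f w\<bar>)"

definition dual_feasible :: "('n::finite \<Rightarrow> real^'d) \<Rightarrow> real^'n \<Rightarrow> bool" where
  "dual_feasible x p \<longleftrightarrow> sphere_sup_norm (K_adj x p) \<le> 1"

definition solves_D0 :: "('n::finite \<Rightarrow> real^'d) \<Rightarrow> real^'n \<Rightarrow> real^'n \<Rightarrow> bool" where
  "solves_D0 x y p \<longleftrightarrow> is_arg_max (\<lambda>q. q \<bullet> y) (dual_feasible x) p"

definition solves_D :: "('n::finite \<Rightarrow> real^'d) \<Rightarrow> real \<Rightarrow> real^'n \<Rightarrow> real^'n \<Rightarrow> bool" where
  "solves_D x lam y p \<longleftrightarrow>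
     is_arg_max (\<lambda>q. y \<bullet> q - lam / 2 * (norm q)\<^sup>2) (dual_feasible x) p"

(* Vectors of R^D are functions nat => real of which only the entries below D matter:
   D has to vary inside one statement, and D = 0 has to be allowed. *)
definition region :: "nat \<Rightarrow> nat \<Rightarrow> (nat \<Rightarrow> nat \<Rightarrow> real) \<Rightarrow> (nat \<Rightarrow> nat) \<Rightarrow> (nat \<Rightarrow> real) set" where
  "region m D a \<pi> =
     {v. \<forall>i<m. (\<pi> i = 1 \<longrightarrow> (\<Sum>l<D. v l * a i l) > 0) \<and>
               (\<pi> i = 0 \<longrightarrow> (\<Sum>l<D. v l * a i l) < 0)}"

definition num_regions :: "nat \<Rightarrow> nat \<Rightarrow> (nat \<Rightarrow> nat \<Rightarrow> real) \<Rightarrow> nat" where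
  "num_regions m D a = card {\<pi> \<in> {..<m} \<rightarrow>\<^sub>E {0, 1}. region m D a \<pi> \<noteq> {}}"

(* The dimension is an int so that it can be negative. The set under Max is finite,
   since num_regions m D a is at most 2^m. *)
definition Xi :: "nat \<Rightarrow> int \<Rightarrow> nat" where
  "Xi m D = (if D < 0 then 0 else Max (range (num_regions m (nat D))))"

end

theory Submission
  imports Defs
begin

text \<open>
  The term \<open>k = 0\<close> alone bounds the number of maximizers. On the closure of a region of the
  arrangement of the hyperplanes orthogonal to the data, \<open>\<eta>\<close> is linear, so by strict convexity of
  the ball this closure contains at most one maximizer of \<open>\<bar>\<eta>\<bar>\<close> with \<open>\<eta> > 0\<close> and at most one
  with \<open>\<eta> < 0\<close>, and nothing else if it contains a maximizer in its interior. A maximizer on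
  some hyperplane lies in the closures of at least two regions, those of \<open>w + \<epsilon> v\<close> and
  \<open>w - \<epsilon> v\<close> for a generic \<open>v\<close>. Double counting of the incidences gives the bound.
\<close>

section \<open>Sign patterns and generic vectors\<close>

definition generic :: "('n \<Rightarrow> 'a::real_inner) \<Rightarrow> 'a \<Rightarrow> bool" where
  "generic x v \<longleftrightarrow> (\<forall>j. v \<bullet> x j \<noteq> 0)"

text \<open>Encodes a sign pattern as the set of its positive indices. On generic vectors its values
  correspond to the non-empty regions of the arrangement.\<close>

definition active :: "('n \<Rightarrow> 'a::real_inner) \<Rightarrow> 'a \<Rightarrow> 'n set" where
  "active x v = {j. v \<bullet> x j > 0}"

text \<open>A convex cone for every \<open>S\<close>; for \<open>S = active x v\<close> with
  \<open>v\<close> generic it is the closure of the region of \<open>v\<close>.\<close>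

definition closed_cell :: "('n \<Rightarrow> 'a::real_inner) \<Rightarrow> 'n set \<Rightarrow> 'a set" where
  "closed_cell x S = {w. \<forall>j. (j \<in> S \<longrightarrow> w \<bullet> x j \<ge> 0) \<and> (j \<notin> S \<longrightarrow> w \<bullet> x j \<le> 0)}"

lemma exists_generic:
  fixes x :: "'n::finite \<Rightarrow> 'a::euclidean_space"
  assumes "\<And>j. x j \<noteq> 0"
  shows "\<exists>v. generic x v"
proof -
  have "negligible (\<Union>j. {v. x j \<bullet> v = 0})"
    using assms by (intro negligible_Union) (auto intro!: negligible_hyperplane)
  then have "(\<Union>j. {v. x j \<bullet> v = 0}) \<noteq> UNIV"
    using non_negligible_UNIV by metis
  then show ?thesis
    by (auto simp: generic_def inner_commute)
qed

text \<open>Adding or subtracting \<open>e * b j\<close> then preserves the sign of every nonzero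
  \<open>a j\<close>; finiteness of the index type gives one \<open>e\<close> for all
  \<open>j\<close>.\<close>

lemma exists_small_step:
  fixes a b :: "'n::finite \<Rightarrow> real"
  shows "\<exists>e>0. \<forall>j. a j \<noteq> 0 \<longrightarrow> e * \<bar>b j\<bar> < \<bar>a j\<bar>"
proof -
  have "\<forall>\<^sub>F e in at_right 0. a j \<noteq> 0 \<longrightarrow> e * \<bar>b j\<bar> < \<bar>a j\<bar>" for j
  proof (cases "a j = 0")
    case False
    have "((\<lambda>e. e * \<bar>b j\<bar>) \<longlongrightarrow> 0 * \<bar>b j\<bar>) (at_right 0)"
      by (intro tendsto_intros)
    then show ?thesis
      using order_tendstoD(2)[of _ "0 * \<bar>b j\<bar>" _ "\<bar>a j\<bar>"] False
      by (auto elim: eventually_mono)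
  qed simp
  then have "\<forall>\<^sub>F e in at_right 0. \<forall>j. a j \<noteq> 0 \<longrightarrow> e * \<bar>b j\<bar> < \<bar>a j\<bar>"
    by (intro eventually_all_finite)
  moreover have "\<forall>\<^sub>F e in at_right (0::real). e > 0"
    by (rule eventually_at_right_less)
  ultimately have "\<forall>\<^sub>F e in at_right 0. e > 0 \<and> (\<forall>j. a j \<noteq> 0 \<longrightarrow> e * \<bar>b j\<bar> < \<bar>a j\<bar>)"
    by eventually_elim simp
  from eventually_happens[OF this] show ?thesis
    by simp
qed

section \<open>Strict convexity of the unit ball\<close>

lemma unit_norm_add_ge_2:
  fixes u w :: "'a::real_inner"
  assumes "norm u = 1" "norm w = 1" "norm (u + w) \<ge> 2"
  shows "u = w"
proof -
  have "(norm (u - w))\<^sup>2 = 4 - (norm (u + w))\<^sup>2"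
    using assms(1,2) by (simp add: power2_norm_eq_inner norm_eq_1 inner_add_left inner_add_right
        inner_diff_left inner_diff_right inner_commute)
  also have "\<dots> \<le> 0"
    using power_mono[OF assms(3), of 2] by simp
  finally show ?thesis
    by simp
qed

text \<open>Equality in the triangle inequality: squaring leaves
  \<open>w \<bullet> u \<le> -1\<close>, the extreme case of Cauchy-Schwarz for unit
  vectors.\<close>

lemma unit_norm_diff_scaleR_ge:
  fixes u w :: "'a::real_inner"
  assumes "norm u = 1" "norm w = 1" "t > 0" "norm (w - t *\<^sub>R u) \<ge> 1 + t"
  shows "u = - w"
proof -
  have "(1 + t)\<^sup>2 \<le> (norm (w - t *\<^sub>R u))\<^sup>2"
    using power_mono[OF assms(4), of 2] assms(3) by simp
  also have "\<dots> = 1 + t\<^sup>2 - 2 * t * (w \<bullet> u)"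
    using assms(1,2) by (simp add: power2_norm_eq_inner norm_eq_1 inner_diff_left
        inner_diff_right inner_commute power2_eq_square[of t])
  finally have "t * (w \<bullet> u) \<le> t * (-1)"
    by (simp add: power2_eq_square algebra_simps)
  then have "w \<bullet> u \<le> -1"
    using assms(3) by (simp only: mult_le_cancel_left_pos)
  then have "(norm (u - (- w)))\<^sup>2 \<le> 0"
    using assms(1,2)
    by (simp add: power2_norm_eq_inner norm_eq_1 inner_add_left inner_add_right inner_commute)
  then show ?thesis
    by (simp add: eq_neg_iff_add_eq_0)
qed

section \<open>Cones and the two sides of a point\<close>

lemma closed_cell_add:
  "u \<in> closed_cell x S \<Longrightarrow> w \<in> closed_cell x S \<Longrightarrow> u + w \<in> closed_cell x S"
  by (auto simp: closed_cell_def inner_add_left add_nonneg_nonneg add_nonpos_nonpos)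

lemma closed_cell_scaleR:
  "0 \<le> c \<Longrightarrow> w \<in> closed_cell x S \<Longrightarrow> c *\<^sub>R w \<in> closed_cell x S"
  by (auto simp: closed_cell_def mult_nonneg_nonneg mult_nonneg_nonpos)

text \<open>A short step along \<open>v\<close> keeps all nonzero signs of \<open>w\<close>, so
  \<open>w\<close> stays in the closure of the region reached; an index with
  \<open>w \<bullet> x j = 0\<close> takes opposite signs on the two sides, which separates the
  regions.\<close>

lemma active_step:
  fixes x :: "'n::finite \<Rightarrow> 'a::real_inner"
  assumes v: "generic x v"
  shows "\<exists>e>0. generic x (w + e *\<^sub>R v) \<and> generic x (w - e *\<^sub>R v) \<and>
    w \<in> closed_cell x (active x (w + e *\<^sub>R v)) \<and> w \<in> closed_cell x (active x (w - e *\<^sub>R v)) \<and>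
    (\<not> generic x w \<longrightarrow> active x (w + e *\<^sub>R v) \<noteq> active x (w - e *\<^sub>R v))"
proof -
  obtain e where e: "e > 0" "\<And>j. w \<bullet> x j \<noteq> 0 \<Longrightarrow> e * \<bar>v \<bullet> x j\<bar> < \<bar>w \<bullet> x j\<bar>"
    using exists_small_step[of "\<lambda>j. w \<bullet> x j" "\<lambda>j. v \<bullet> x j"] by blast
  \<comment> \<open>Makes \<open>e * (v \<bullet> x j)\<close> an atom, so that the sign arguments
    below become linear.\<close>
  have abs_e: "e * \<bar>v \<bullet> x j\<bar> = \<bar>e * (v \<bullet> x j)\<bar>" for j
    using e(1) by (simp add: abs_mult)
  have ev: "e * (v \<bullet> x j) \<noteq> 0" for j
    using v e(1) by (simp add: generic_def)
  have "active x (w + e *\<^sub>R v) \<noteq> active x (w - e *\<^sub>R v)" if "\<not> generic x w"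
  proof -
    from that have "\<exists>j. w \<bullet> x j = 0"
      by (simp add: generic_def)
    then obtain j where "w \<bullet> x j = 0" ..
    then have "j \<in> active x (w + e *\<^sub>R v) \<longleftrightarrow> j \<notin> active x (w - e *\<^sub>R v)"
      using linorder_neqE[OF ev[of j]] less_asym
      by (auto simp: active_def inner_add_left inner_diff_left)
    then show ?thesis
      by blast
  qed
  moreover have "w \<bullet> x j + e * (v \<bullet> x j) \<noteq> 0 \<and> w \<bullet> x j - e * (v \<bullet> x j) \<noteq> 0" for j
    using e(2)[of j] ev[of j] unfolding abs_e by linarith
  moreover have "(w \<bullet> x j + e * (v \<bullet> x j) > 0 \<longrightarrow> w \<bullet> x j \<ge> 0) \<and>
      (\<not> w \<bullet> x j + e * (v \<bullet> x j) > 0 \<longrightarrow> w \<bullet> x j \<le> 0) \<and>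
      (w \<bullet> x j - e * (v \<bullet> x j) > 0 \<longrightarrow> w \<bullet> x j \<ge> 0) \<and>
      (\<not> w \<bullet> x j - e * (v \<bullet> x j) > 0 \<longrightarrow> w \<bullet> x j \<le> 0)" for j
    using e(2)[of j] unfolding abs_e by linarith
  ultimately show ?thesis
    using e(1)
    by (intro exI[of _ e])
      (simp add: generic_def closed_cell_def active_def inner_add_left inner_diff_left)
qed

section \<open>The certificate on one closed cell\<close>

text \<open>On a cell each \<open>relu\<close> is either the identity or zero; where an inner
  product vanishes both readings agree.\<close>

lemma K_adj_on_closed_cell:
  assumes "w \<in> closed_cell x S"
  shows "K_adj x p w = (\<Sum>j\<in>S. p $ j *\<^sub>R x j) \<bullet> w"
proof -
  have "K_adj x p w = (\<Sum>j\<in>UNIV. if j \<in> S then p $ j * (w \<bullet> x j) else 0)"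
    unfolding K_adj_def using assms
    by (intro sum.cong) (auto simp: closed_cell_def relu_def max_def intro: antisym)
  also have "\<dots> = (\<Sum>j\<in>S. p $ j *\<^sub>R x j) \<bullet> w"
    by (simp add: sum.If_cases inner_sum_left inner_commute[of w])
  finally show ?thesis .
qed

text \<open>Homogeneity carries the bound from the sphere to the whole cone, where it is applied to
  the non-unit vectors \<open>u + w\<close> and \<open>w - t *\<^sub>R u\<close>.\<close>

lemma K_adj_le_norm:
  assumes max: "\<And>z. norm z = 1 \<Longrightarrow> \<bar>K_adj x p z\<bar> \<le> M"
    and z: "z \<in> closed_cell x S"
  shows "\<bar>(\<Sum>j\<in>S. p $ j *\<^sub>R x j) \<bullet> z\<bar> \<le> M * norm z"
proof (cases "z = 0")
  case False
  define z' where "z' = (1 / norm z) *\<^sub>R z"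
  have "z' \<in> closed_cell x S"
    unfolding z'_def by (intro closed_cell_scaleR z) simp
  moreover have "norm z' = 1"
    using False by (simp add: z'_def)
  ultimately have "\<bar>(\<Sum>j\<in>S. p $ j *\<^sub>R x j) \<bullet> z'\<bar> \<le> M"
    using max[of z'] K_adj_on_closed_cell[of z' x S p] by simp
  then show ?thesis
    using False by (simp add: z'_def abs_mult field_simps)
qed simp

text \<open>Linearity gives absolute value \<open>2 * M\<close> at \<open>u + w\<close>, which
  forces \<open>norm (u + w) \<ge> 2\<close>.\<close>

lemma maximizer_unique_same_value:
  assumes max: "\<And>z. norm z = 1 \<Longrightarrow> \<bar>K_adj x p z\<bar> \<le> M"
    and "M > 0" "norm u = 1" "norm w = 1"
    and cell: "u \<in> closed_cell x S" "w \<in> closed_cell x S"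
    and val: "\<bar>K_adj x p u\<bar> = M" "K_adj x p w = K_adj x p u"
  shows "u = w"
proof -
  have "\<bar>(\<Sum>j\<in>S. p $ j *\<^sub>R x j) \<bullet> (u + w)\<bar> = 2 * M"
    using val by (simp add: inner_add_right flip: K_adj_on_closed_cell[OF cell(1)]
        K_adj_on_closed_cell[OF cell(2)])
  then have "2 * M \<le> M * norm (u + w)"
    using K_adj_le_norm[OF max closed_cell_add[OF cell]] by simp
  then have "norm (u + w) \<ge> 2"
    using \<open>M > 0\<close> by simp
  then show ?thesis
    by (rule unit_norm_add_ge_2[OF assms(3,4)])
qed

text \<open>A generic \<open>w\<close> is interior to the cell, so one can move from
  \<open>w\<close> slightly away from \<open>u\<close>. If the values at \<open>u\<close> and
  \<open>w\<close> are opposite, this increases the absolute value at the largest possible rate,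
  which forces \<open>u = - w\<close>.\<close>

lemma maximizer_unique_generic:
  fixes x :: "'n::finite \<Rightarrow> real^'d"
  assumes max: "\<And>z. norm z = 1 \<Longrightarrow> \<bar>K_adj x p z\<bar> \<le> M"
    and M: "M > 0" and unit: "norm u = 1" "norm w = 1"
    and cell: "u \<in> closed_cell x S" "w \<in> closed_cell x S"
    and val: "\<bar>K_adj x p u\<bar> = M" "\<bar>K_adj x p w\<bar> = M"
    and gen: "generic x w"
  shows "u = w"
proof (cases "K_adj x p w = K_adj x p u")
  case True
  then show ?thesis
    using maximizer_unique_same_value[OF max M unit cell val(1)] by simp
next
  case False
  then have opp: "K_adj x p u = - K_adj x p w"
    using val by linarith
  obtain t where t: "t > 0" "\<And>j. w \<bullet> x j \<noteq> 0 \<Longrightarrow> t * \<bar>u \<bullet> x j\<bar> < \<bar>w \<bullet> x j\<bar>"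
    using exists_small_step[of "\<lambda>j. w \<bullet> x j" "\<lambda>j. u \<bullet> x j"] by blast
  have less: "\<bar>t * (u \<bullet> x j)\<bar> < \<bar>w \<bullet> x j\<bar>" for j
    using t gen by (simp add: generic_def abs_mult)
  have "(j \<in> S \<longrightarrow> w \<bullet> x j - t * (u \<bullet> x j) \<ge> 0) \<and> (j \<notin> S \<longrightarrow> w \<bullet> x j - t * (u \<bullet> x j) \<le> 0)" for j
  proof -
    have "(j \<in> S \<longrightarrow> w \<bullet> x j \<ge> 0) \<and> (j \<notin> S \<longrightarrow> w \<bullet> x j \<le> 0)"
      using cell(2) by (simp add: closed_cell_def)
    then show ?thesis
      using less[of j] by linarith
  qed
  then have "w - t *\<^sub>R u \<in> closed_cell x S"
    by (simp add: closed_cell_def inner_diff_left)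
  from K_adj_le_norm[OF max this]
  have "\<bar>K_adj x p w - t * K_adj x p u\<bar> \<le> M * norm (w - t *\<^sub>R u)"
    by (simp add: inner_diff_right K_adj_on_closed_cell[OF cell(1)] K_adj_on_closed_cell[OF cell(2)])
  moreover have "\<bar>K_adj x p w - t * K_adj x p u\<bar> = M * (1 + t)"
  proof -
    have "K_adj x p w - t * K_adj x p u = K_adj x p w * (1 + t)"
      by (simp add: opp algebra_simps)
    then show ?thesis
      using val(2) t(1) by (simp add: abs_mult)
  qed
  ultimately have "norm (w - t *\<^sub>R u) \<ge> 1 + t"
    using M by simp
  then have "u = - w"
    using unit t(1) by (intro unit_norm_diff_scaleR_ge)
  \<comment> \<open>The cell contains both \<open>w\<close> and \<open>- w\<close>, so each inner
    product is at once nonnegative and nonpositive.\<close>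
  then have "w \<bullet> x j = 0" for j
    using cell by (cases "j \<in> S") (auto simp: closed_cell_def intro!: antisym)
  then show ?thesis
    using gen by (simp add: generic_def)
qed

section \<open>Counting the maximizers\<close>

lemma card_maximizers_le_card_active:
  fixes x :: "'n::finite \<Rightarrow> real^'d::finite"
  assumes nz: "\<And>j. x j \<noteq> 0"
    and max: "\<And>z. norm z = 1 \<Longrightarrow> \<bar>K_adj x p z\<bar> \<le> M" and M: "M > 0"
    and W: "\<And>w. w \<in> W \<Longrightarrow> norm w = 1 \<and> \<bar>K_adj x p w\<bar> = M"
  shows "finite W \<and> card W \<le> card (active x ` Collect (generic x))"
proof -
  obtain v where v: "generic x v"
    using exists_generic[of x, OF nz] by blast
  from active_step[OF v] obtain e where e:
    "\<And>w. e w > 0 \<and> generic x (w + e w *\<^sub>R v) \<and> generic x (w - e w *\<^sub>R v) \<and>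
    w \<in> closed_cell x (active x (w + e w *\<^sub>R v)) \<and> w \<in> closed_cell x (active x (w - e w *\<^sub>R v)) \<and>
    (\<not> generic x w \<longrightarrow> active x (w + e w *\<^sub>R v) \<noteq> active x (w - e w *\<^sub>R v))"
    by metis
  \<comment> \<open>The two sides are one and the same region if \<open>w\<close> is generic, and
    distinct regions otherwise.\<close>
  define side where "side w b = active x (if b then w + e w *\<^sub>R v else w - e w *\<^sub>R v)" for w b
  have cell: "w \<in> closed_cell x (side w b)" for w b
    using e[of w] by (simp add: side_def)
  have side_neq: "b = b'" if "side w b = side w b'" "\<not> generic x w" for w b b'
    using that e[of w] by (cases b; cases b') (auto simp: side_def)
  \<comment> \<open>A region has two slots: one per sign of \<open>\<eta>\<close>, or, if it contains a maximizer in its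
    interior, one for each of the two coinciding sides of that maximizer.\<close>
  define \<phi> where "\<phi> = (\<lambda>(w, b). (side w b, if generic x w then b else K_adj x p w > 0))"
  have inj: "inj_on \<phi> (W \<times> UNIV)"
  proof (rule inj_onI, clarify)
    fix w b w' b'
    assume w: "w \<in> W" "w' \<in> W" and eq: "\<phi> (w, b) = \<phi> (w', b')"
    have sides: "side w b = side w' b'"
      using eq by (simp add: \<phi>_def)
    have cells: "w \<in> closed_cell x (side w b)" "w' \<in> closed_cell x (side w b)"
      using cell[of w b] cell[of w' b'] sides by simp_all
    have unit: "norm w = 1" "norm w' = 1" and val: "\<bar>K_adj x p w\<bar> = M" "\<bar>K_adj x p w'\<bar> = M"
      using W w by auto
    \<comment> \<open>If neither point is generic, the second component of \<open>\<phi>\<close> is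
      the sign of the certificate, so the two values agree.\<close>
    have same: "w = w'"
    proof (cases "generic x w \<or> generic x w'")
      case True
      then show ?thesis
        using maximizer_unique_generic[OF max M unit cells val]
          maximizer_unique_generic[OF max M unit(2,1) cells(2,1) val(2,1)] by auto
    next
      case False
      then have "(K_adj x p w > 0) = (K_adj x p w' > 0)"
        using eq by (simp add: \<phi>_def)
      then have "K_adj x p w' = K_adj x p w"
        using val by linarith
      then show ?thesis
        using maximizer_unique_same_value[OF max M unit cells val(1)] by simp
    qed
    moreover have "b = b'"
      using eq side_neq[of w b b'] same by (cases "generic x w") (auto simp: \<phi>_def)
    ultimately show "w = w' \<and> b = b'" ..
  qed
  have im: "\<phi> ` (W \<times> UNIV) \<subseteq> active x ` Collect (generic x) \<times> UNIV"
    using e by (auto simp: \<phi>_def side_def)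
  have fin: "finite (active x ` Collect (generic x) \<times> (UNIV :: bool set))"
    by simp
  have "finite (W \<times> (UNIV :: bool set))"
    using inj im fin by (rule inj_on_finite)
  then have "finite W"
    by (auto simp: finite_cartesian_product_iff)
  moreover have "card (W \<times> (UNIV :: bool set))
      \<le> card (active x ` Collect (generic x) \<times> (UNIV :: bool set))"
    using inj im fin by (rule card_inj_on_le)
  \<comment> \<open>The factor 2 from \<open>bool\<close> occurs in both products and
    cancels.\<close>
  ultimately show ?thesis
    by (simp add: card_cartesian_product)
qed

text \<open>The sphere consists of two generic points with different sign patterns, so the bound
  holds for any set of unit vectors, even when the certificate vanishes.\<close>

lemma card_unit_le_card_active_dim1:
  fixes x :: "'n::finite \<Rightarrow> real^'d::finite"
  assumes dim: "CARD('d) = 1" and nz: "\<And>j. x j \<noteq> 0" and W: "W \<subseteq> sphere (0 :: real^'d) 1"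
  shows "finite W \<and> card W \<le> card (active x ` Collect (generic x))"
proof -
  obtain i :: 'd where i: "(UNIV :: 'd set) = {i}"
    using dim by (auto simp: card_1_singleton_iff)
  have all_i: "k = i" for k :: 'd
    using i by auto
  have inner: "w \<bullet> z = w $ i * z $ i" for w z :: "real^'d"
    by (simp add: inner_vec_def i)
  have unit: "\<bar>w $ i\<bar> = 1" if "w \<in> W" for w
  proof -
    have "norm w = 1"
      using that W by auto
    then show ?thesis
      by (simp add: norm_vec_def L2_set_def i)
  qed
  have xi: "x j $ i \<noteq> 0" for j
    using nz[of j] all_i by (metis vec_eq_iff zero_index)
  have inj: "inj_on (active x) W"
  proof (rule inj_onI)
    fix w w'
    assume w: "w \<in> W" "w' \<in> W" and eq: "active x w = active x w'"
    \<comment> \<open>A single data point distinguishes the two signs; one exists since types are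
      non-empty.\<close>
    fix j :: 'n
    have "(w $ i * x j $ i > 0) = (w' $ i * x j $ i > 0)"
      using eq by (auto simp: active_def inner)
    then have "w $ i = w' $ i"
      using unit[OF w(1)] unit[OF w(2)] xi[of j]
      by (auto simp: abs_if zero_less_mult_iff split: if_splits)
    then show "w = w'"
      using all_i by (metis vec_eq_iff)
  qed
  have im: "active x ` W \<subseteq> active x ` Collect (generic x)"
    using unit xi by (fastforce simp: generic_def inner)
  show ?thesis
    using inj_on_finite[OF inj im] card_inj_on_le[OF inj im] by simp
qed

section \<open>Comparison with \<open>Xi\<close>\<close>

lemma num_regions_le_Xi: "num_regions m D a \<le> Xi m (int D)"
proof -
  have "num_regions m D b \<le> 2 ^ m" for b
  proof -
    have "num_regions m D b \<le> card ({..<m} \<rightarrow>\<^sub>E {0, 1 :: nat})"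
      unfolding num_regions_def by (intro card_mono finite_PiE) auto
    then show ?thesis
      by (simp add: card_PiE numeral_2_eq_2)
  qed
  then have "finite (range (num_regions m D))"
    by (auto intro: finite_subset[of _ "{..2 ^ m}"])
  then show ?thesis
    by (simp add: Xi_def)
qed

lemma card_active_le_Xi:
  fixes x :: "'n::finite \<Rightarrow> real^'d::finite"
  shows "card (active x ` Collect (generic x)) \<le> Xi CARD('n) (int CARD('d))"
proof -
  obtain f :: "nat \<Rightarrow> 'n" where f: "bij_betw f {..<CARD('n)} UNIV"
    using ex_bij_betw_nat_finite[of "UNIV :: 'n set"] by (auto simp: lessThan_atLeast0)
  obtain g :: "nat \<Rightarrow> 'd" where g: "bij_betw g {..<CARD('d)} UNIV"
    using ex_bij_betw_nat_finite[of "UNIV :: 'd set"] by (auto simp: lessThan_atLeast0)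
  define a where "a i l = x (f i) $ g l" for i l
  \<comment> \<open>The restriction puts \<open>\<psi> S\<close> into the extensional function space
    over which \<open>num_regions\<close> counts.\<close>
  define \<psi> where "\<psi> S = (\<lambda>i\<in>{..<CARD('n)}. if f i \<in> S then 1 else 0 :: nat)" for S
  let ?R = "{\<pi> \<in> {..<CARD('n)} \<rightarrow>\<^sub>E {0, 1}. region CARD('n) CARD('d) a \<pi> \<noteq> {}}"
  have inner: "(\<Sum>l<CARD('d). v $ g l * a i l) = v \<bullet> x (f i)" for v i
    using sum.reindex_bij_betw[OF g, of "\<lambda>k. v $ k * x (f i) $ k"]
    by (simp add: inner_vec_def a_def)
  have "inj \<psi>"
  proof (rule injI)
    fix S T
    assume eq: "\<psi> S = \<psi> T"
    have "f i \<in> S \<longleftrightarrow> f i \<in> T" if "i < CARD('n)" for i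
      using fun_cong[OF eq, of i] that by (auto simp: \<psi>_def split: if_splits)
    moreover have "\<exists>i<CARD('n). j = f i" for j
      using f by (auto simp: bij_betw_def)
    ultimately show "S = T"
      by (metis subset_antisym subsetI)
  qed
  then have "inj_on \<psi> (active x ` Collect (generic x))"
    by (rule inj_on_subset) simp
  moreover have "\<psi> ` active x ` Collect (generic x) \<subseteq> ?R"
  proof clarify
    fix v
    assume v: "generic x v"
    \<comment> \<open>The witness lists the coordinates of \<open>v\<close> in the order
      \<open>g\<close>; genericity makes the inequalities at inactive indices strict.\<close>
    have "(\<lambda>l. v $ g l) \<in> region CARD('n) CARD('d) a (\<psi> (active x v))"
      using v by (auto simp: region_def inner \<psi>_def active_def generic_def not_less le_less)
    then show "\<psi> (active x v) \<in> {..<CARD('n)} \<rightarrow>\<^sub>E {0, 1} \<and>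
        region CARD('n) CARD('d) a (\<psi> (active x v)) \<noteq> {}"
      by (auto simp: \<psi>_def)
  qed
  moreover have "finite ?R"
    by (rule finite_subset[of _ "{..<CARD('n)} \<rightarrow>\<^sub>E {0, 1}"]) (auto intro: finite_PiE)
  ultimately have "card (active x ` Collect (generic x)) \<le> num_regions CARD('n) CARD('d) a"
    unfolding num_regions_def by (rule card_inj_on_le)
  also have "\<dots> \<le> Xi CARD('n) (int CARD('d))"
    by (rule num_regions_le_Xi)
  finally show ?thesis .
qed

text \<open>\<open>nondegenerate\<close> excludes exactly the case where \<open>\<eta>\<close>
  vanishes on a sphere in dimension at least 2: there every point is a maximizer and the set is
  infinite.\<close>

theorem lemma3p11:
  fixes x :: "'n::finite \<Rightarrow> real^'d::finite"
    and y0 \<zeta> :: "real^'n"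
    and lam :: real
    and \<eta> :: "real^'d \<Rightarrow> real"
  assumes data_nonzero: "\<And>j. x j \<noteq> 0"
    and lam_pos: "lam > 0"
    and certificate:
      "(\<exists>p0. solves_D0 x y0 p0 \<and> \<eta> = K_adj x p0) \<or>
       (\<exists>p. solves_D x lam (y0 + \<zeta>) p \<and> \<eta> = K_adj x p)"
    and nondegenerate: "CARD('d) = 1 \<or> (\<exists>w\<in>sphere 0 1. \<eta> w \<noteq> 0)"
  shows "finite {w. is_arg_max (\<lambda>w. \<bar>\<eta> w\<bar>) (\<lambda>w. w \<in> sphere 0 1) w} \<and>
         card {w. is_arg_max (\<lambda>w. \<bar>\<eta> w\<bar>) (\<lambda>w. w \<in> sphere 0 1) w}
           \<le> Max ((\<lambda>k. (CARD('n) choose k) * Xi (CARD('n) - k) (int CARD('d) - int k))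
                    ` {0..CARD('n)})"
proof -
  obtain p where p: "\<eta> = K_adj x p"
    using certificate by blast
  let ?W = "{w. is_arg_max (\<lambda>w. \<bar>\<eta> w\<bar>) (\<lambda>w. w \<in> sphere 0 1) w}"
  let ?F = "\<lambda>k. (CARD('n) choose k) * Xi (CARD('n) - k) (int CARD('d) - int k)"
  have "finite ?W \<and> card ?W \<le> card (active x ` Collect (generic x))"
  proof (cases "CARD('d) = 1")
    case True
    have "?W \<subseteq> sphere 0 1"
      by (auto simp: is_arg_max_def)
    then show ?thesis
      by (rule card_unit_le_card_active_dim1[of x, OF True data_nonzero])
  next
    case False
    then obtain w0 where w0: "norm w0 = 1" "\<eta> w0 \<noteq> 0"
      using nondegenerate by auto
    show ?thesis
    proof (cases "?W = {}")
      case True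
      then show ?thesis by simp
    next
      case False
      then obtain m where m: "m \<in> ?W"
        by blast
      then have max: "\<bar>\<eta> z\<bar> \<le> \<bar>\<eta> m\<bar>" if "norm z = 1" for z
        using that by (auto simp: is_arg_max_def not_less)
      \<comment> \<open>Supplies the positive level \<open>M\<close> for the counting lemma.\<close>
      have "\<bar>\<eta> m\<bar> > 0"
        using max[OF w0(1)] w0(2) by linarith
      moreover have "norm w = 1 \<and> \<bar>\<eta> w\<bar> = \<bar>\<eta> m\<bar>" if "w \<in> ?W" for w
        using that m by (auto simp: is_arg_max_def not_less intro!: antisym)
      ultimately show ?thesis
        using card_maximizers_le_card_active[of x p "\<bar>\<eta> m\<bar>" ?W, OF data_nonzero] max
        unfolding p by blast
    qed
  qed
  moreover have "card (active x ` Collect (generic x)) \<le> ?F 0"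
    using card_active_le_Xi[of x] by simp
  moreover have "?F 0 \<le> Max (?F ` {0..CARD('n)})"
    by (intro Max_ge imageI) auto
  ultimately show ?thesis
    by linarith
qed

end
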